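(* Let $k$ be a field. (1) Let $C_1\in k$ be such that $-C_1$ is not a square in $k$ (in particular, this holds if $k$ is an ordered field and $C_1$ is positive). Then $x_1,x_2\in k$ satisfy $x_1^2+C_1x_2^2=1$ if and only if there are $s_1,s_2\in k$, not both zero, such that $$x_1=\frac{s_1^2-C_1s_2^2}{s_1^2+C_1s_2^2}\quad\text{and}\quad x_2=\frac{2s_1s_2}{s_1^2+C_1s_2^2}.$$ (2) Let $k$ be an ordered field and let $C_1,C_2\in k$ be positive. Then $x_1,x_2,x_3,x_4\in k$ satisfy $x_1^2+C_1x_2^2+C_2x_3^2+C_1C_2x_4^2=1$ if and only if there are $s_1,s_2,s_3,s_4\in k$, not all zero, such that $$x_1=\frac{s_1^2-C_1s_2^2-C_2s_3^2-C_1C_2s_4^2}{s_1^2+C_1s_2^2+C_2s_3^2+C_1C_2s_4^2}\quad\text{and}\quad x_i=\frac{2s_1s_i}{s_1^2+C_1s_2^2+C_2s_3^2+C_1C_2s_4^2}\ \text{ for } i=2,3,4.$$ (3) Let $k$ be an ordered field and let $C_1,C_2,C_3\in k$ be positive. Then $x_1,\dots,x_8\in k$ satisfy $$x_1^2+C_1x_2^2+C_2x_3^2+C_1C_2x_4^2+C_3x_5^2+C_1C_3x_6^2+C_2C_3x_7^2+C_1C_2C_3x_8^2=1$$ if and only if there are $s_1,\dots,s_8\in k$, not all zero, such that, with $$N=s_1^2+C_1s_2^2+C_2s_3^2+C_1C_2s_4^2+C_3s_5^2+C_1C_3s_6^2+C_2C_3s_7^2+C_1C_2C_3s_8^2,$$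 one has $$x_1=\frac{s_1^2-C_1s_2^2-C_2s_3^2-C_1C_2s_4^2-C_3s_5^2-C_1C_3s_6^2-C_2C_3s_7^2-C_1C_2C_3s_8^2}{N}\quad\text{and}\quad x_i=\frac{2s_1s_i}{N}\ \text{ for } 2\le i\le 8.$$
   Context: A field $k$ is ordered if it carries a total order $\le$ such that $a\le b$ implies $a+c\le b+c$, and $0\le a$, $0\le b$ imply $0\le ab$. An element $a$ is positive if $0\le a$ and $a\ne 0$. *)

theory Defs
  imports "HOL-Computational_Algebra.Nth_Powers"
begin

end

(*
  Outside characteristic 2, if the form s0^2 + q(s) is anisotropic, the line through (-1, 0) in
  direction (s0, s) with s0 nonzero meets the quadric x0^2 + q(x) = 1 in exactly one further point,
  which gives the parametrisation; the tangent directions s0 = 0 give (-1, 0) itself. Conversely,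
  x is reached by s0 = 1 + x0, s = x, for which s0^2 + q(s) = 2 (1 + x0). In characteristic 2 this
  value vanishes, so anisotropy leaves only the point (-1, 0), and no separate treatment is needed.
*)

theory Submission
  imports Defs
begin

text \<open>Lists let one argument serve forms with 1, 3 and 7 variables besides the leading one.
  The catch-all equation ignores surplus entries of the longer list, hence the length hypotheses
  below.\<close>

fun diag_form :: "'a :: comm_ring_1 list \<Rightarrow> 'a list \<Rightarrow> 'a" where
  "diag_form (c # cs) (x # xs) = c * x^2 + diag_form cs xs"
| "diag_form _ _ = 0"

lemma diag_form_scale: "diag_form cs (map ((*) a) xs) = a^2 * diag_form cs xs"
  by (induction cs xs rule: diag_form.induct) (simp_all add: algebra_simps)

lemma diag_form_nonneg:
  fixes cs :: "'a :: linordered_field list"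
  assumes "\<forall>c\<in>set cs. c > 0"
  shows "diag_form cs xs \<ge> 0"
  using assms by (induction cs xs rule: diag_form.induct) (simp_all add: less_imp_le)

text \<open>A vanishing sum of nonnegative terms has only zero terms, and a positive coefficient can
  be cancelled.\<close>

lemma diag_form_eq_0_imp:
  fixes cs :: "'a :: linordered_field list"
  assumes "length xs = length cs" and "\<forall>c\<in>set cs. c > 0" and "diag_form cs xs = 0"
  shows "set xs \<subseteq> {0}"
  using assms
proof (induction xs cs rule: list_induct2)
  case (Cons x xs c cs)
  have "c * x^2 \<ge> 0" "diag_form cs xs \<ge> 0" using Cons.prems(1) diag_form_nonneg by auto
  then have "c * x^2 = 0" "diag_form cs xs = 0"
    using Cons.prems(2) by (simp_all add: add_nonneg_eq_0_iff)
  then show ?case using Cons by simp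
qed simp

text \<open>The common consequence of the non-square and positivity hypotheses through which the
  coefficients enter the parametrisation: all its denominators are nonzero.\<close>

definition one_plus_anisotropic :: "'a :: comm_ring_1 list \<Rightarrow> bool" where
  "one_plus_anisotropic cs \<longleftrightarrow>
     (\<forall>t0 ts. length ts = length cs \<longrightarrow> t0^2 + diag_form cs ts = 0 \<longrightarrow> t0 = 0 \<and> set ts \<subseteq> {0})"

lemma one_plus_anisotropic_if_pos:
  fixes cs :: "'a :: linordered_field list"
  assumes "\<forall>c\<in>set cs. c > 0"
  shows "one_plus_anisotropic cs"
  unfolding one_plus_anisotropic_def
proof (intro allI impI)
  fix t0 ts assume len: "length ts = length cs" and "t0^2 + diag_form cs ts = 0"
  then have "t0^2 = 0 \<and> diag_form cs ts = 0"
    using diag_form_nonneg[OF assms, of ts] by (simp add: add_nonneg_eq_0_iff)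
  then show "t0 = 0 \<and> set ts \<subseteq> {0}" using diag_form_eq_0_imp[OF len assms] by simp
qed

text \<open>A zero of the form with nonzero second coordinate would exhibit \<open>- C\<close> as
  the square of the ratio of the coordinates.\<close>

lemma one_plus_anisotropic_if_nonsquare:
  fixes C :: "'a :: field"
  assumes "\<not> is_square (- C)"
  shows "one_plus_anisotropic [C]"
  unfolding one_plus_anisotropic_def
proof (intro allI impI)
  fix t0 :: 'a and ts assume "length ts = length [C]" and form: "t0^2 + diag_form [C] ts = 0"
  then obtain t1 where ts: "ts = [t1]" by (auto simp: length_Suc_conv)
  have "t1 = 0"
  proof (rule ccontr)
    assume "t1 \<noteq> 0"
    then have "- C = (t0 / t1)^2"
      using form ts by (simp add: field_simps neg_eq_iff_add_eq_0)
    then show False using assms by (metis is_nth_powerI)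
  qed
  then show "t0 = 0 \<and> set ts \<subseteq> {0}" using form ts by simp
qed

lemma not_is_square_uminus_pos:
  fixes C :: "'a :: linordered_field"
  assumes "C > 0"
  shows "\<not> is_square (- C)"
proof
  assume "is_square (- C)"
  then obtain y where "- C = y^2" by (auto elim: is_nth_powerE)
  then show False using assms zero_le_power2[of y] by simp
qed

text \<open>Nonemptiness of \<open>cs\<close> provides a direction with \<open>s0 = 0\<close>. For
  empty \<open>cs\<close> the fraction would only yield \<open>x0 = 1\<close>, missing the solution
  \<open>- 1\<close>.\<close>

lemma quadric_parametrization:
  fixes cs xs :: "'a :: field list" and x0 :: 'a
  assumes "one_plus_anisotropic cs"
    and len: "length xs = length cs" and "cs \<noteq> []"
  shows "x0^2 + diag_form cs xs = 1 \<longleftrightarrow>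
    (\<exists>s0 ss. length ss = length cs \<and> (s0 \<noteq> 0 \<or> (\<exists>s\<in>set ss. s \<noteq> 0)) \<and>
       x0 = (s0^2 - diag_form cs ss) / (s0^2 + diag_form cs ss) \<and>
       xs = map (\<lambda>s. 2 * s0 * s / (s0^2 + diag_form cs ss)) ss)"
    (is "?quadric \<longleftrightarrow> ?param")
proof -
  have aniso: "t0 = 0 \<and> set ts \<subseteq> {0}"
    if "length ts = length cs" "t0^2 + diag_form cs ts = 0" for t0 ts
    using assms(1) that unfolding one_plus_anisotropic_def by blast
  show ?thesis
  proof
    assume q: ?quadric
    show ?param
    proof (cases "x0 = - 1")
      case True
      then have "diag_form cs xs = 0" using q by simp
      then have "set xs \<subseteq> {0}" using aniso[OF len, of 0] by simp
      then have xs: "xs = replicate (length cs) 0"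
        using len by (metis replicate_eqI singletonD subsetD)
      \<comment> \<open>With \<open>s0 = 0\<close> every nonzero \<open>ss\<close> yields the point
        with \<open>x0 = - 1\<close> and all other coordinates 0; the all-ones vector is a
        convenient choice.\<close>
      let ?e = "replicate (length cs) (1 :: 'a)"
      have "diag_form cs ?e \<noteq> 0" using aniso[of ?e 0] \<open>cs \<noteq> []\<close> by auto
      then show ?thesis
        using True xs \<open>cs \<noteq> []\<close> by (intro exI[of _ 0] exI[of _ ?e]) (auto simp: map_replicate_const)
    next
      case False
      then have ne: "1 + x0 \<noteq> 0" by (simp add: eq_neg_iff_add_eq_0 add.commute)
      have Q: "diag_form cs xs = 1 - x0^2" using q by (simp add: algebra_simps)
      have N: "(1 + x0)^2 + diag_form cs xs = 2 * (1 + x0)"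
        unfolding Q by (simp add: power2_eq_square algebra_simps)
      \<comment> \<open>If this value were 0, then by \<open>N\<close> the form would vanish at a
        vector with nonzero first coordinate \<open>1 + x0\<close>. So anisotropy takes the place of
        an assumption on the characteristic.\<close>
      have D: "2 * (1 + x0) \<noteq> 0" using aniso[OF len, of "1 + x0"] ne N by metis
      have "(1 + x0)^2 - diag_form cs xs = x0 * (2 * (1 + x0))"
        unfolding Q by (simp add: power2_eq_square algebra_simps)
      then have "x0 = ((1 + x0)^2 - diag_form cs xs) / ((1 + x0)^2 + diag_form cs xs)"
        unfolding N by (simp only: nonzero_mult_div_cancel_right[OF D])
      moreover have "xs = map (\<lambda>x. 2 * (1 + x0) * x / ((1 + x0)^2 + diag_form cs xs)) xs"
        unfolding N using D by simp
      ultimately show ?thesis using ne len by blast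
    qed
  next
    assume ?param
    then obtain s0 ss where ss: "length ss = length cs" "s0 \<noteq> 0 \<or> (\<exists>s\<in>set ss. s \<noteq> 0)"
      and x0: "x0 = (s0^2 - diag_form cs ss) / (s0^2 + diag_form cs ss)"
      and xs: "xs = map (\<lambda>s. 2 * s0 * s / (s0^2 + diag_form cs ss)) ss"
      by blast
    define q N where "q = diag_form cs ss" and "N = s0^2 + q"
    \<comment> \<open>Division by zero yields 0 in HOL, so the equations for \<open>x0\<close> and
      \<open>xs\<close> do not by themselves exclude a zero denominator; anisotropy does.\<close>
    have N: "N \<noteq> 0" using aniso[OF ss(1), of s0] ss(2) unfolding N_def q_def by auto
    \<comment> \<open>All entries share the factor \<open>2 * s0 / N\<close>, so homogeneity of
      degree 2 pulls its square out of the form.\<close>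
    have "xs = map ((*) (2 * s0 / N)) ss" by (simp add: xs N_def q_def)
    then have "diag_form cs xs = (2 * s0 / N)^2 * q" by (simp only: diag_form_scale q_def)
    moreover have "x0 = (s0^2 - q) / N" by (simp add: x0 N_def q_def)
    ultimately have "x0^2 + diag_form cs xs = ((s0^2 - q)^2 + (2 * s0)^2 * q) / N^2"
      by (simp add: power_divide add_divide_distrib)
    also have "(s0^2 - q)^2 + (2 * s0)^2 * q = N^2"
      unfolding N_def by (simp add: power2_eq_square algebra_simps)
    finally show ?quadric using N by simp
  qed
qed

lemma ex_length_0: "(\<exists>xs. length xs = 0 \<and> P xs) \<longleftrightarrow> P []"
  by simp

text \<open>As a rewrite rule, together with \<open>ex_length_0\<close>, this turns a quantifier
  over lists of fixed numeral length into quantifiers over the entries.\<close>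

lemma ex_length_Suc:
  "(\<exists>xs. length xs = Suc n \<and> P xs) \<longleftrightarrow> (\<exists>x xs. length xs = n \<and> P (x # xs))"
  by (metis length_Suc_conv)

lemma conic_parametrization:
  fixes C x0 x1 :: "'a :: field"
  assumes "\<not> is_square (- C)"
  shows "x0^2 + C * x1^2 = 1 \<longleftrightarrow>
    (\<exists>s0 s1. (s0 \<noteq> 0 \<or> s1 \<noteq> 0) \<and>
       x0 = (s0^2 - C * s1^2) / (s0^2 + C * s1^2) \<and>
       x1 = (2 * s0 * s1) / (s0^2 + C * s1^2))"
  using quadric_parametrization[OF one_plus_anisotropic_if_nonsquare[OF assms], of "[x1]" x0]
  by (simp add: ex_length_Suc ex_length_0)

text \<open>The coefficients are independent here; the quaternionic pattern arises by taking
  \<open>c2\<close> to be the product of \<open>c0\<close> and \<open>c1\<close>.\<close>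

lemma pos_quadric_parametrization_3:
  fixes c0 c1 c2 x0 x1 x2 x3 :: "'a :: linordered_field"
  assumes "c0 > 0" "c1 > 0" "c2 > 0"
  shows "x0^2 + c0 * x1^2 + c1 * x2^2 + c2 * x3^2 = 1 \<longleftrightarrow>
    (\<exists>s0 s1 s2 s3. (s0 \<noteq> 0 \<or> s1 \<noteq> 0 \<or> s2 \<noteq> 0 \<or> s3 \<noteq> 0) \<and>
      (let N = s0^2 + c0 * s1^2 + c1 * s2^2 + c2 * s3^2 in
        x0 = (s0^2 - c0 * s1^2 - c1 * s2^2 - c2 * s3^2) / N \<and>
        x1 = (2 * s0 * s1) / N \<and> x2 = (2 * s0 * s2) / N \<and> x3 = (2 * s0 * s3) / N))"
proof -
  have "one_plus_anisotropic [c0, c1, c2]"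
    by (rule one_plus_anisotropic_if_pos) (simp add: assms)
  from quadric_parametrization[OF this, of "[x1, x2, x3]" x0] show ?thesis
    \<comment> \<open>Reassociation matches the right-nested sum of \<open>diag_form\<close> with
      the left-nested sums and differences of the statement. Deleting \<open>disj_not1\<close> keeps
      the disjunction of inequalities from becoming an implication.\<close>
    by (simp add: ex_length_Suc ex_length_0 Let_def add.assoc diff_diff_eq del: disj_not1)
qed

lemma pos_quadric_parametrization_7:
  fixes c0 c1 c2 c3 c4 c5 c6 x0 x1 x2 x3 x4 x5 x6 x7 :: "'a :: linordered_field"
  assumes "c0 > 0" "c1 > 0" "c2 > 0" "c3 > 0" "c4 > 0" "c5 > 0" "c6 > 0"
  shows "x0^2 + c0 * x1^2 + c1 * x2^2 + c2 * x3^2 + c3 * x4^2 + c4 * x5^2 + c5 * x6^2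
      + c6 * x7^2 = 1 \<longleftrightarrow>
    (\<exists>s0 s1 s2 s3 s4 s5 s6 s7.
      (s0 \<noteq> 0 \<or> s1 \<noteq> 0 \<or> s2 \<noteq> 0 \<or> s3 \<noteq> 0 \<or> s4 \<noteq> 0 \<or> s5 \<noteq> 0 \<or> s6 \<noteq> 0 \<or> s7 \<noteq> 0) \<and>
      (let N = s0^2 + c0 * s1^2 + c1 * s2^2 + c2 * s3^2 + c3 * s4^2 + c4 * s5^2 + c5 * s6^2
          + c6 * s7^2 in
        x0 = (s0^2 - c0 * s1^2 - c1 * s2^2 - c2 * s3^2 - c3 * s4^2 - c4 * s5^2 - c5 * s6^2
          - c6 * s7^2) / N \<and>
        x1 = (2 * s0 * s1) / N \<and> x2 = (2 * s0 * s2) / N \<and> x3 = (2 * s0 * s3) / N \<and>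
        x4 = (2 * s0 * s4) / N \<and> x5 = (2 * s0 * s5) / N \<and> x6 = (2 * s0 * s6) / N \<and>
        x7 = (2 * s0 * s7) / N))"
proof -
  have "one_plus_anisotropic [c0, c1, c2, c3, c4, c5, c6]"
    by (rule one_plus_anisotropic_if_pos) (simp add: assms)
  from quadric_parametrization[OF this, of "[x1, x2, x3, x4, x5, x6, x7]" x0] show ?thesis
    by (simp add: ex_length_Suc ex_length_0 Let_def add.assoc diff_diff_eq del: disj_not1)
qed

theorem mainTheorem6:
  shows
    "(\<forall>C1 :: 'a :: field. \<not> is_square (- C1) \<longrightarrow>
       (\<forall>x1 x2 :: 'a.
         x1^2 + C1 * x2^2 = 1 \<longleftrightarrow>
         (\<exists>s1 s2. (s1 \<noteq> 0 \<or> s2 \<noteq> 0) \<and>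
            x1 = (s1^2 - C1 * s2^2) / (s1^2 + C1 * s2^2) \<and>
            x2 = (2 * s1 * s2) / (s1^2 + C1 * s2^2)))) \<and>
     (\<forall>C1 :: 'b :: linordered_field. C1 > 0 \<longrightarrow> \<not> is_square (- C1)) \<and>
     (\<forall>C1 C2 :: 'b. C1 > 0 \<longrightarrow> C2 > 0 \<longrightarrow>
       (\<forall>x1 x2 x3 x4 :: 'b.
         x1^2 + C1 * x2^2 + C2 * x3^2 + C1 * C2 * x4^2 = 1 \<longleftrightarrow>
         (\<exists>s1 s2 s3 s4. (s1 \<noteq> 0 \<or> s2 \<noteq> 0 \<or> s3 \<noteq> 0 \<or> s4 \<noteq> 0) \<and>
           (let N = s1^2 + C1 * s2^2 + C2 * s3^2 + C1 * C2 * s4^2 in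
              x1 = (s1^2 - C1 * s2^2 - C2 * s3^2 - C1 * C2 * s4^2) / N \<and>
              x2 = (2 * s1 * s2) / N \<and>
              x3 = (2 * s1 * s3) / N \<and>
              x4 = (2 * s1 * s4) / N)))) \<and>
     (\<forall>C1 C2 C3 :: 'b. C1 > 0 \<longrightarrow> C2 > 0 \<longrightarrow> C3 > 0 \<longrightarrow>
       (\<forall>x1 x2 x3 x4 x5 x6 x7 x8 :: 'b.
         x1^2 + C1 * x2^2 + C2 * x3^2 + C1 * C2 * x4^2
           + C3 * x5^2 + C1 * C3 * x6^2 + C2 * C3 * x7^2 + C1 * C2 * C3 * x8^2 = 1 \<longleftrightarrow>
         (\<exists>s1 s2 s3 s4 s5 s6 s7 s8.
           (s1 \<noteq> 0 \<or> s2 \<noteq> 0 \<or> s3 \<noteq> 0 \<or> s4 \<noteq> 0 \<or> s5 \<noteq> 0 \<or> s6 \<noteq> 0 \<or> s7 \<noteq> 0 \<or> s8 \<noteq> 0) \<and>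
           (let N = s1^2 + C1 * s2^2 + C2 * s3^2 + C1 * C2 * s4^2
                    + C3 * s5^2 + C1 * C3 * s6^2 + C2 * C3 * s7^2 + C1 * C2 * C3 * s8^2 in
              x1 = (s1^2 - C1 * s2^2 - C2 * s3^2 - C1 * C2 * s4^2
                    - C3 * s5^2 - C1 * C3 * s6^2 - C2 * C3 * s7^2 - C1 * C2 * C3 * s8^2) / N \<and>
              x2 = (2 * s1 * s2) / N \<and>
              x3 = (2 * s1 * s3) / N \<and>
              x4 = (2 * s1 * s4) / N \<and>
              x5 = (2 * s1 * s5) / N \<and>
              x6 = (2 * s1 * s6) / N \<and>
              x7 = (2 * s1 * s7) / N \<and>
              x8 = (2 * s1 * s8) / N))))"
  \<comment> \<open>\<open>mult_pos_pos\<close> supplies positivity of the coefficients that are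
    products of the \<open>C1\<close>, \<open>C2\<close>, \<open>C3\<close>.\<close>
  by (intro conjI allI impI conic_parametrization not_is_square_uminus_pos
      pos_quadric_parametrization_3 pos_quadric_parametrization_7 mult_pos_pos)

end
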